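(* Let $g$ and $N$ be positive integers, let $\mathcal A\subseteq\{0,1,\dots,N\}$ be a $B_2[g]$ set, and let $b$ be an admissible function. Then $$D_{\mathcal A}(b)\le\Big(I_1(w_b)+\frac{A(w_b)}{4N^2}\Big)|\mathcal A|^2+\big(w_b(0)-I_1(w_b)\big)|\mathcal A| +\Big(\sqrt{2\big(I_2(w_b)-I_1(w_b)^2\big)}+\frac{A(w_b)}{2N^{3/2}}\Big)\sqrt{(2g-1)N|\mathcal A|^2-\frac{|\mathcal A|^4}{2}+|\mathcal A|^3}.$$
   Context: A set $\mathcal A$ of integers is a $B_2[g]$ set if for every integer $n$ there are at most $g$ pairs $(a,b)\in\mathcal A^2$ with $a\le b$ and $a+b=n$. A function $b$ is admissible if its domain $\mathcal S_b\subset\mathbb R$ is countable, symmetric about $0$ and contains $0$, $b:\mathcal S_b\to[0,\infty)$ is even (write $b_\theta=b(\theta)$), and $\sum_{\theta\in\mathcal S_b}b_\theta<\infty$. Set $w_b(t)=\sum_{\theta\in\mathcal S_b}b_\theta\cos(2\pi\theta t)$ (an even $C^\infty$ function). For $n\in\mathbb Z$ let $d(n)=|\{(a,a')\in\mathcal A^2: a-a'=n\}|$, and $D_{\mathcal A}(b)=\sum_{|n|\le N}d(n)\,w_b(n/N)$. For an even $C^2$ function $w$: $I_1(w)=\int_0^1 w(t)\,dt$, $I_2(w)=\int_0^1 w(t)^2\,dt$, $A(w)=|w'(1)|+\max_{t\in[0,1]}|w''(t)|$.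
   Formalization: The formal theorem additionally assumes that w_b is C^2; admissibility alone does not imply it (θ = ±2^k with b_θ = 2^{-k} gives a nowhere differentiable w_b), and without it A(w_b) is undefined. *)

theory Defs
  imports "HOL-Analysis.Analysis"
begin

text \<open>The finiteness conjunct matters only for infinite sets, for which \<open>card\<close> could be \<open>0\<close>.\<close>

definition B2_set :: "nat \<Rightarrow> int set \<Rightarrow> bool" where
  "B2_set g A \<longleftrightarrow>
     (\<forall>n. finite {(a, b). a \<in> A \<and> b \<in> A \<and> a \<le> b \<and> a + b = n} \<and>
          card {(a, b). a \<in> A \<and> b \<in> A \<and> a \<le> b \<and> a + b = n} \<le> g)"

text \<open>A function with domain \<open>S\<close> is given by \<open>S\<close> together with a total function \<open>b\<close>, whose
  values outside \<open>S\<close> are never used.\<close>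

definition admissible :: "real set \<Rightarrow> (real \<Rightarrow> real) \<Rightarrow> bool" where
  "admissible S b \<longleftrightarrow>
     countable S \<and> 0 \<in> S \<and> (\<forall>\<theta>\<in>S. - \<theta> \<in> S) \<and>
     (\<forall>\<theta>\<in>S. b \<theta> \<ge> 0) \<and> (\<forall>\<theta>\<in>S. b (- \<theta>) = b \<theta>) \<and> b summable_on S"

definition weight :: "real set \<Rightarrow> (real \<Rightarrow> real) \<Rightarrow> real \<Rightarrow> real" where
  "weight S b t = (\<Sum>\<^sub>\<infinity>\<theta>\<in>S. b \<theta> * cos (2 * pi * \<theta> * t))"

definition diff_count :: "int set \<Rightarrow> int \<Rightarrow> nat" where
  "diff_count A n = card {(a, a'). a \<in> A \<and> a' \<in> A \<and> a - a' = n}"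

definition D_sum :: "nat \<Rightarrow> int set \<Rightarrow> real set \<Rightarrow> (real \<Rightarrow> real) \<Rightarrow> real" where
  "D_sum N A S b =
     (\<Sum>n\<in>{- int N..int N}. real (diff_count A n) * weight S b (real_of_int n / real N))"

text \<open>Admissibility alone makes \<open>weight S b\<close> continuous but, when \<open>S\<close> is unbounded, not
  necessarily differentiable; \<open>A_const\<close> below is meaningful for \<open>C\<^sup>2\<close> functions only.\<close>

definition C2_function :: "(real \<Rightarrow> real) \<Rightarrow> bool" where
  "C2_function w \<longleftrightarrow>
     (\<forall>t. w differentiable at t) \<and> (\<forall>t. deriv w differentiable at t) \<and>
     continuous_on UNIV (deriv (deriv w))"

definition I1 :: "(real \<Rightarrow> real) \<Rightarrow> real" where
  "I1 w = integral {0..1} w"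

definition I2 :: "(real \<Rightarrow> real) \<Rightarrow> real" where
  "I2 w = integral {0..1} (\<lambda>t. (w t)\<^sup>2)"

text \<open>For \<open>C\<^sup>2\<close> functions the supremum is a maximum, by compactness; \<open>Max\<close> is specified
  for finite sets only.\<close>

definition A_const :: "(real \<Rightarrow> real) \<Rightarrow> real" where
  "A_const w = \<bar>deriv w 1\<bar> + (SUP t\<in>{0..1}. \<bar>deriv (deriv w) t\<bar>)"

end

theory Submission
  imports Defs
begin

text \<open>Put \<open>w = weight S b\<close> and \<open>d = diff_count A\<close>. Both are even, so \<open>D_sum\<close> is \<open>w 0 * card A\<close> plus twice a sum over \<open>{1..N}\<close>,
  which is a trapezoid sum on the nodes \<open>n / N\<close> of \<open>{0..1}\<close>. Cauchy--Schwarz for the centred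
  functions separates \<open>d\<close> from \<open>w\<close>. The second moment of \<open>d\<close> is an additive energy, so it is
  also the second moment of the representation function of \<open>A + A\<close>, which is at most \<open>2 * g\<close>.
  Write \<open>\<sigma>\<^sup>2 = I2 w - (I1 w)\<^sup>2\<close>.
  By the Peano kernel the sampled variance of \<open>w\<close> exceeds \<open>\<sigma>\<^sup>2\<close> by \<open>O(1 / N\<^sup>2)\<close> times the
  integrals of \<open>w'\<^sup>2\<close> and \<open>\<bar>(w - I1 w) * w''\<bar>\<close>. Integration by parts bounds the former by
  \<open>\<sigma>\<close> and \<open>A_const w\<close>, and the excess is absorbed in the square
  \<open>(\<sigma> + A_const w / (2 * sqrt 2 * N powr (3 / 2)))\<^sup>2\<close>.\<close>

section \<open>The error of the trapezoid rule\<close>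

text \<open>The integral of \<open>(x * \<bar>f t\<bar> - y * \<bar>h t\<bar>)\<^sup>2\<close> is a
  nonnegative quadratic form in \<open>x\<close> and \<open>y\<close>, which bounds its mixed
  coefficient \<open>Q\<close>.\<close>

lemma Cauchy_Schwarz_integral:
  fixes f h :: "real \<Rightarrow> real"
  assumes f: "continuous_on {a..b} f" and h: "continuous_on {a..b} h"
  shows "integral {a..b} (\<lambda>t. \<bar>f t * h t\<bar>)
    \<le> sqrt (integral {a..b} (\<lambda>t. (f t)\<^sup>2)) * sqrt (integral {a..b} (\<lambda>t. (h t)\<^sup>2))"
proof -
  define P where "P = integral {a..b} (\<lambda>t. (f t)\<^sup>2)"
  define R where "R = integral {a..b} (\<lambda>t. (h t)\<^sup>2)"
  define Q where "Q = integral {a..b} (\<lambda>t. \<bar>f t * h t\<bar>)"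
  have P0: "P \<ge> 0" and R0: "R \<ge> 0"
    unfolding P_def R_def
    using f h by (auto intro!: integral_nonneg integrable_continuous_real continuous_intros)
  have quad: "x\<^sup>2 * P - 2 * (x * y) * Q + y\<^sup>2 * R \<ge> 0" for x y
  proof -
    have "((\<lambda>t. x\<^sup>2 * (f t)\<^sup>2 - 2 * (x * y) * \<bar>f t * h t\<bar> + y\<^sup>2 * (h t)\<^sup>2) has_integral
        (x\<^sup>2 * P - 2 * (x * y) * Q + y\<^sup>2 * R)) {a..b}"
      unfolding P_def R_def Q_def using f h
      by (intro has_integral_add has_integral_diff has_integral_mult_right integrable_integral
            integrable_continuous_real continuous_intros)
    moreover have "x\<^sup>2 * (f t)\<^sup>2 - 2 * (x * y) * \<bar>f t * h t\<bar> + y\<^sup>2 * (h t)\<^sup>2 \<ge> 0" for t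
      using zero_le_power2[of "x * \<bar>f t\<bar> - y * \<bar>h t\<bar>"]
      by (simp add: power2_diff power_mult_distrib abs_mult algebra_simps)
    ultimately show ?thesis by (rule has_integral_nonneg)
  qed
  have "Q\<^sup>2 \<le> P * R"
  proof (cases "P = 0")
    case True
    \<comment> \<open>For \<open>P = 0\<close> the form is linear in \<open>x\<close>, so a large
      enough multiplier forces \<open>Q = 0\<close>.\<close>
    have "2 * (R + 1) * Q * Q \<le> R * Q * Q"
      using quad[of "R + 1" "Q"] True by (simp add: power2_eq_square algebra_simps)
    then have "(R + 2) * Q\<^sup>2 \<le> 0" by (simp add: power2_eq_square algebra_simps)
    then have "Q\<^sup>2 \<le> 0" using R0 by (simp add: mult_le_0_iff)
    then show ?thesis using True by simp
  next
    case False
    \<comment> \<open>For \<open>y = P\<close> the form is smallest at \<open>x = Q\<close>.\<close>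
    have "P * Q\<^sup>2 \<le> P * (P * R)"
      using quad[of Q P] by (simp add: power2_eq_square algebra_simps)
    then show ?thesis using False P0 by simp
  qed
  then have "Q \<le> sqrt (P * R)" by (rule real_le_rsqrt)
  then show ?thesis by (simp add: P_def Q_def R_def real_sqrt_mult)
qed

text \<open>The Peano kernel \<open>(t - u) * (v - t) / 2\<close> of the trapezoid rule lies between \<open>0\<close> and
  \<open>(v - u)\<^sup>2 / 8\<close>.\<close>

lemma trapezoid_step:
  fixes G G' G'' E :: "real \<Rightarrow> real"
  assumes "u \<le> v"
    and G: "\<And>t. (G has_real_derivative G' t) (at t)"
    and G': "\<And>t. (G' has_real_derivative G'' t) (at t)"
    and E: "continuous_on {u..v} E" "\<And>t. t \<in> {u..v} \<Longrightarrow> 0 \<le> E t"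
    and le: "\<And>t. t \<in> {u..v} \<Longrightarrow> G'' t \<le> E t"
  shows "(v - u) * (G u + G v) / 2 \<le> integral {u..v} G + (v - u)\<^sup>2 / 8 * integral {u..v} E"
proof -
  define K where "K t = (t - u) * (v - t) / 2" for t
  \<comment> \<open>As \<open>K\<close> has derivative \<open>(u + v) / 2 - t\<close>, the terms in
    \<open>G'\<close> cancel in the derivative of \<open>\<Phi>\<close>. As \<open>K\<close>
    vanishes at \<open>u\<close> and \<open>v\<close>, the boundary values of \<open>\<Phi>\<close>
    leave only the trapezoid.\<close>
  define \<Phi> where "\<Phi> t = K t * G' t - ((u + v) / 2 - t) * G t" for t
  have "(\<Phi> has_real_derivative K t * G'' t + G t) (at t)" for t
    unfolding \<Phi>_def K_def
    by (rule derivative_eq_intros G G' refl | simp add: field_simps)+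
  then have "((\<lambda>t. K t * G'' t + G t) has_integral (\<Phi> v - \<Phi> u)) {u..v}"
    using \<open>u \<le> v\<close>
    by (intro fundamental_theorem_of_calculus)
      (auto simp: has_real_derivative_iff_has_vector_derivative[symmetric] intro: has_field_derivative_at_within)
  moreover have "\<Phi> v - \<Phi> u = (v - u) * (G u + G v) / 2"
    by (simp add: \<Phi>_def K_def field_simps)
  ultimately have lhs: "((\<lambda>t. K t * G'' t + G t) has_integral (v - u) * (G u + G v) / 2) {u..v}"
    by simp
  have contG: "continuous_on {u..v} G"
    using G by (meson DERIV_continuous_on has_field_derivative_at_within)
  have rhs: "((\<lambda>t. G t + (v - u)\<^sup>2 / 8 * E t) has_integral
      integral {u..v} G + (v - u)\<^sup>2 / 8 * integral {u..v} E) {u..v}"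
    using contG E by (intro has_integral_add has_integral_mult_right integrable_integral
      integrable_continuous_real)
  show ?thesis
  proof (rule has_integral_le[OF lhs rhs])
    fix t assume t: "t \<in> {u..v}"
    have "0 \<le> K t" using t by (simp add: K_def)
    moreover have "K t \<le> (v - u)\<^sup>2 / 8"
      using zero_le_power2[of "(t - u) - (v - t)"]
      by (simp add: K_def power2_eq_square field_simps)
    \<comment> \<open>First \<open>G''\<close> is raised to \<open>E\<close>, using
      \<open>0 \<le> K t\<close>; then \<open>K\<close> is raised to its maximum, using
      \<open>0 \<le> E t\<close>.\<close>
    ultimately have "K t * G'' t \<le> (v - u)\<^sup>2 / 8 * E t"
      using le[OF t] E(2)[OF t] by (meson mult_left_mono mult_right_mono order_trans)
    then show "K t * G'' t + G t \<le> G t + (v - u)\<^sup>2 / 8 * E t" by simp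
  qed
qed

text \<open>The one-panel bound is summed over \<open>N\<close> panels of width
  \<open>1 / N\<close>. The error stays an integral of the majorant \<open>E\<close>, not a
  supremum, so that mean-square estimates can be used on it.\<close>

lemma trapezoid_rule:
  fixes G G' G'' E :: "real \<Rightarrow> real"
  assumes "N > 0"
    and G: "\<And>t. (G has_real_derivative G' t) (at t)"
    and G': "\<And>t. (G' has_real_derivative G'' t) (at t)"
    and E: "continuous_on {0..1} E" "\<And>t. t \<in> {0..1} \<Longrightarrow> 0 \<le> E t"
    and le: "\<And>t. t \<in> {0..1} \<Longrightarrow> G'' t \<le> E t"
  shows "(\<Sum>n<N. (G (n / real N) + G (Suc n / real N)) / 2) / N
    \<le> integral {0..1} G + integral {0..1} E / (8 * real N ^ 2)"
proof -
  have contG: "continuous_on X G" for X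
    using G by (meson DERIV_continuous_on has_field_derivative_at_within)
  have "k \<le> N \<Longrightarrow> (\<Sum>n<k. (G (n / real N) + G (Suc n / real N)) / 2) / N
    \<le> integral {0..k / N} G + integral {0..k / N} E / (8 * real N ^ 2)" for k
  proof (induction k)
    case 0
    then show ?case by simp
  next
    case (Suc k)
    let ?u = "k / real N" and ?v = "Suc k / real N"
    have uv: "0 \<le> ?u" "?u \<le> ?v" "?v \<le> 1" and d: "?v - ?u = 1 / N"
      using Suc.prems \<open>N > 0\<close> by (auto simp: field_simps)
    have sub: "{?u..?v} \<subseteq> {0..1}" using uv by auto
    have "(?v - ?u) * (G ?u + G ?v) / 2
        \<le> integral {?u..?v} G + (?v - ?u)\<^sup>2 / 8 * integral {?u..?v} E"
    proof (rule trapezoid_step[OF uv(2) G G'])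
      show "continuous_on {?u..?v} E" using E(1) sub by (rule continuous_on_subset)
    qed (use sub E(2) le in blast)+
    then have "(G ?u + G ?v) / 2 / N
        \<le> integral {?u..?v} G + integral {?u..?v} E / (8 * real N ^ 2)"
      unfolding d by (simp add: power_divide field_simps)
    moreover have "integral {0..?v} G = integral {0..?u} G + integral {?u..?v} G"
      by (rule Henstock_Kurzweil_Integration.integral_combine[OF uv(1,2) integrable_continuous_real[OF contG], symmetric])
    moreover have "integral {0..?v} E = integral {0..?u} E + integral {?u..?v} E"
      using uv by (intro Henstock_Kurzweil_Integration.integral_combine[symmetric] integrable_continuous_real
        continuous_on_subset[OF E(1)]) auto
    ultimately show ?case using Suc by (simp add: add_divide_distrib)
  qed
  from this[of N] show ?thesis using \<open>N > 0\<close> by simp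
qed

text \<open>Since \<open>f'\<close> vanishes at \<open>0\<close>, integration by parts leaves only the boundary term at \<open>1\<close>,
  which is controlled because \<open>f\<close> has a zero.\<close>

lemma integral_derivative_square_le:
  fixes f f' f'' :: "real \<Rightarrow> real"
  assumes f: "\<And>t. (f has_real_derivative f' t) (at t)"
    and f': "\<And>t. (f' has_real_derivative f'' t) (at t)"
    and cont: "continuous_on {0..1} f''"
    and W: "\<And>t. t \<in> {0..1} \<Longrightarrow> \<bar>f'' t\<bar> \<le> W"
    and "f' 0 = 0" and mean: "integral {0..1} f = 0"
  defines "\<sigma> \<equiv> sqrt (integral {0..1} (\<lambda>t. (f t)\<^sup>2))"
    and "X \<equiv> sqrt (integral {0..1} (\<lambda>t. (f' t)\<^sup>2))"
  shows "integral {0..1} (\<lambda>t. \<bar>f t\<bar>) \<le> \<sigma>"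
    and "X\<^sup>2 \<le> \<bar>f' 1\<bar> * sqrt (2 * \<sigma> * X) + \<sigma> * W"
proof -
  have contf: "continuous_on Y f" and contf': "continuous_on Y f'" for Y
    using f f' by (meson DERIV_continuous_on has_field_derivative_at_within)+
  show l1: "integral {0..1} (\<lambda>t. \<bar>f t\<bar>) \<le> \<sigma>"
    using Cauchy_Schwarz_integral[OF contf, of 0 1 "\<lambda>_. 1"] by (simp add: \<sigma>_def)
  have W0: "W \<ge> 0" using W[of 0] by simp
  have X2: "X\<^sup>2 = integral {0..1} (\<lambda>t. (f' t)\<^sup>2)"
    unfolding X_def by (intro real_sqrt_pow2 integral_nonneg integrable_continuous_real
      continuous_intros contf') auto
  \<comment> \<open>Integrating the derivative of \<open>f * f'\<close> is the integration by parts
    for the square of \<open>f'\<close>.\<close>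
  have "((\<lambda>t. f t * f' t) has_real_derivative (f' t)\<^sup>2 + f t * f'' t) (at t)" for t
    by (rule derivative_eq_intros f f' refl | simp)+ (simp add: power2_eq_square)
  then have "((\<lambda>t. (f' t)\<^sup>2 + f t * f'' t) has_integral (f 1 * f' 1 - f 0 * f' 0)) {0..1}"
    by (intro fundamental_theorem_of_calculus)
      (auto simp: has_real_derivative_iff_has_vector_derivative[symmetric] intro: has_field_derivative_at_within)
  then have "f 1 * f' 1 = integral {0..1} (\<lambda>t. (f' t)\<^sup>2 + f t * f'' t)"
    using \<open>f' 0 = 0\<close> by (simp add: integral_unique)
  also have "\<dots> = X\<^sup>2 + integral {0..1} (\<lambda>t. f t * f'' t)"
    unfolding X2 by (intro integral_add integrable_continuous_real continuous_intros contf contf' cont)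
  finally have parts: "X\<^sup>2 = f 1 * f' 1 - integral {0..1} (\<lambda>t. f t * f'' t)" by simp
  have "- integral {0..1} (\<lambda>t. f t * f'' t) \<le> integral {0..1} (\<lambda>t. W * \<bar>f t\<bar>)"
    unfolding integral_neg[symmetric]
  proof (intro integral_le integrable_continuous_real continuous_intros contf cont)
    fix t :: real assume t: "t \<in> {0..1}"
    have "- (f t * f'' t) \<le> \<bar>f'' t\<bar> * \<bar>f t\<bar>" by (metis abs_ge_minus_self abs_mult mult.commute)
    also have "\<dots> \<le> W * \<bar>f t\<bar>" using W[OF t] by (intro mult_right_mono) auto
    finally show "- (f t * f'' t) \<le> W * \<bar>f t\<bar>" .
  qed
  also have "\<dots> \<le> W * \<sigma>" using l1 W0 by (simp add: mult_left_mono)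
  finally have curv: "- integral {0..1} (\<lambda>t. f t * f'' t) \<le> \<sigma> * W" by (simp add: mult.commute)
  \<comment> \<open>The primitive of \<open>f\<close> vanishes at both \<open>0\<close> and
    \<open>1\<close>, because \<open>f\<close> has mean zero; the mean value theorem then gives a
    zero of \<open>f\<close>.\<close>
  obtain z where z: "z \<in> {0..1}" "f z = 0"
  proof -
    define F where "F t = integral {0..t} f" for t
    have "(F has_real_derivative f t) (at t within {0..1})" if "t \<in> {0..1}" for t
      unfolding F_def using integral_has_real_derivative[OF contf that] .
    then obtain y where "y \<in> {0<..<1}" "F 1 - F 0 = (1 - 0) * f y"
      using mvt_simple[of 0 1 F "\<lambda>t. (*) (f t)"]
      by (auto simp: has_field_derivative_def mult.commute)
    then show thesis using that[of y] mean by (simp add: F_def)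
  qed
  \<comment> \<open>The value at \<open>1\<close> is recovered from the zero \<open>z\<close> by
    integrating the derivative of the square of \<open>f\<close>; Cauchy--Schwarz then bounds it by
    \<open>\<sigma>\<close> and \<open>X\<close>.\<close>
  have "((\<lambda>t. (f t)\<^sup>2) has_real_derivative 2 * (f t * f' t)) (at t)" for t
    by (rule derivative_eq_intros f f' refl | simp)+
  then have "((\<lambda>t. 2 * (f t * f' t)) has_integral ((f 1)\<^sup>2 - (f z)\<^sup>2)) {z..1}"
    using z by (intro fundamental_theorem_of_calculus)
      (auto simp: has_real_derivative_iff_has_vector_derivative[symmetric] intro: has_field_derivative_at_within)
  then have "integral {z..1} (\<lambda>t. 2 * (f t * f' t)) = (f 1)\<^sup>2 - (f z)\<^sup>2"
    by (rule integral_unique)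
  then have "(f 1)\<^sup>2 = integral {z..1} (\<lambda>t. 2 * (f t * f' t))"
    using z(2) by (simp only:) simp
  also have "\<dots> \<le> integral {z..1} (\<lambda>t. 2 * \<bar>f t * f' t\<bar>)"
    by (intro integral_le integrable_continuous_real continuous_intros contf contf') auto
  also have "\<dots> \<le> integral {0..1} (\<lambda>t. 2 * \<bar>f t * f' t\<bar>)"
    using z by (intro integral_subset_le integrable_continuous_real continuous_intros contf contf') auto
  also have "\<dots> \<le> 2 * (\<sigma> * X)"
    using Cauchy_Schwarz_integral[OF contf contf', of 0 1] by (simp add: \<sigma>_def X_def)
  finally have "\<bar>f 1\<bar> \<le> sqrt (2 * \<sigma> * X)" by (intro real_le_rsqrt) (simp add: mult.assoc)
  then have "\<bar>f' 1\<bar> * \<bar>f 1\<bar> \<le> \<bar>f' 1\<bar> * sqrt (2 * \<sigma> * X)"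
    by (intro mult_left_mono) auto
  moreover have "f 1 * f' 1 \<le> \<bar>f' 1\<bar> * \<bar>f 1\<bar>"
    using abs_ge_self[of "f 1 * f' 1"] by (simp add: abs_mult mult.commute)
  ultimately show "X\<^sup>2 \<le> \<bar>f' 1\<bar> * sqrt (2 * \<sigma> * X) + \<sigma> * W" using parts curv by linarith
qed

text \<open>Here \<open>s\<close> stands for the standard deviation of the weight, \<open>X\<close>
  for the L2 norm of its derivative, \<open>p\<close> for \<open>\<bar>w' 1\<bar>\<close> and
  \<open>W\<close> for the bound on \<open>w''\<close>. The hypothesis bounds \<open>X\<close> only
  implicitly; two applications of the inequality of means, balanced by \<open>sqrt N\<close>, make
  it explicit in the shape of an expanded square.\<close>

lemma sampling_interpolation:
  fixes N p s W X :: real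
  assumes "N \<ge> 1" "p \<ge> 0" "s \<ge> 0" "W \<ge> 0" "X \<ge> 0"
    and X: "X\<^sup>2 \<le> p * sqrt (2 * s * X) + s * W"
  shows "s\<^sup>2 + (X\<^sup>2 + s * W) / (4 * N\<^sup>2) \<le> (s + (p + W) / (2 * sqrt 2 * N powr (3 / 2)))\<^sup>2"
proof -
  define r where "r = sqrt N"
  have r: "r \<ge> 1" "N = r\<^sup>2" using assms by (auto simp: r_def)
  have powr: "N powr (3 / 2) = r ^ 3"
  proof -
    have "N powr (3 / 2) = N powr (1 + 1 / 2)" by simp
    also have "\<dots> = N * r" unfolding powr_add using assms by (simp add: powr_half_sqrt r_def)
    also have "\<dots> = r ^ 3" using r by (simp add: power2_eq_square power3_eq_cube)
    finally show ?thesis .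
  qed
  \<comment> \<open>This serves for \<open>7 / 3 \<le> 2 * sqrt 2\<close>, where
    \<open>2 * sqrt 2\<close> comes from the cross term of the target square.\<close>
  have sq2: "sqrt 2 \<ge> 7 / 5" by (rule real_le_rsqrt) (simp add: power2_eq_square)
  have am: "p * sqrt (2 * s * X) \<le> X\<^sup>2 / 4 + s * p * r + p\<^sup>2 / (4 * r\<^sup>2)"
  proof -
    have a: "sqrt (2 * s * X) \<le> s * r + X / (2 * r)"
    proof (rule real_le_lsqrt)
      show "0 \<le> s * r + X / (2 * r)" using assms r by simp
      show "2 * s * X \<le> (s * r + X / (2 * r))\<^sup>2"
        using zero_le_power2[of "s * r - X / (2 * r)"] r by (simp add: power2_eq_square field_simps)
    qed
    \<comment> \<open>Only a quarter of \<open>X\<^sup>2\<close> is spent, so it can be moved to the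
      left side at the cost of a factor \<open>4 / 3\<close>.\<close>
    have "p * X / (2 * r) \<le> X\<^sup>2 / 4 + p\<^sup>2 / (4 * r\<^sup>2)"
      using zero_le_power2[of "X / 2 - p / (2 * r)"] r by (simp add: power2_eq_square field_simps)
    moreover have "p * sqrt (2 * s * X) \<le> p * (s * r + X / (2 * r))"
      using a \<open>p \<ge> 0\<close> by (rule mult_left_mono)
    ultimately show ?thesis by (simp add: algebra_simps)
  qed
  define Y where "Y = p\<^sup>2 / r\<^sup>2"
  have "X\<^sup>2 \<le> 4 / 3 * (s * p * r) + Y / 3 + 4 / 3 * (s * W)"
    using X am by (simp add: Y_def)
  moreover have "s * W \<le> s * W * r" "0 \<le> s * p * r" "0 \<le> s * W * r" "0 \<le> Y"
    using r assms mult_left_mono[of 1 r "s * W"] by (auto simp: Y_def)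
  ultimately have "X\<^sup>2 + s * W \<le> 7 / 3 * (s * (p + W) * r) + Y / 2"
    by (simp add: algebra_simps)
  also have "s * (p + W) * r * (7 / 3) \<le> s * (p + W) * r * (2 * sqrt 2)"
    using assms r sq2 by (intro mult_left_mono) auto
  then have "7 / 3 * (s * (p + W) * r) + Y / 2 \<le> 2 * sqrt 2 * (s * (p + W) * r) + (p + W)\<^sup>2 / r\<^sup>2 / 2"
    using assms r by (intro add_mono divide_right_mono) (auto simp: Y_def power_mono divide_right_mono mult_ac)
  finally have "(X\<^sup>2 + s * W) / (4 * N\<^sup>2)
      \<le> (2 * sqrt 2 * (s * (p + W) * r) + (p + W)\<^sup>2 / r\<^sup>2 / 2) / (4 * N\<^sup>2)"
    by (intro divide_right_mono) auto
  also have "s\<^sup>2 + \<dots> = (s + (p + W) / (2 * sqrt 2 * r ^ 3))\<^sup>2"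
  proof -
    have "2 * sqrt 2 * (s * (p + W) * r) / (4 * N\<^sup>2) = 2 * s * ((p + W) / (2 * sqrt 2 * r ^ 3))"
      using r by (simp add: field_simps power2_eq_square power3_eq_cube)
    moreover have "(p + W)\<^sup>2 / r\<^sup>2 / 2 / (4 * N\<^sup>2) = ((p + W) / (2 * sqrt 2 * r ^ 3))\<^sup>2"
      using r by (simp add: power_divide power_mult_distrib field_simps flip: power_mult power_add)
    ultimately show ?thesis by (simp add: power2_sum add_divide_distrib)
  qed
  finally show ?thesis by (simp add: powr)
qed

section \<open>Additive energy\<close>

lemma sum_card_fibre:
  assumes "finite P" "finite R" "h ` P \<subseteq> R"
  shows "(\<Sum>n\<in>R. card {p \<in> P. h p = n}) = card P"
  using sum.group[OF assms, of "\<lambda>_. 1::nat"] by simp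

text \<open>A fibre of size \<open>k\<close> contains \<open>k\<^sup>2\<close> ordered pairs. Second
  moments thus become cardinalities, which a bijection can compare.\<close>

lemma sum_card_fibre_square:
  assumes "finite P" "finite R" "h ` P \<subseteq> R"
  shows "(\<Sum>n\<in>R. (card {p \<in> P. h p = n})\<^sup>2) = card {(p, q). p \<in> P \<and> q \<in> P \<and> h q = h p}"
proof -
  have "(\<Sum>n\<in>R. (card {p \<in> P. h p = n})\<^sup>2)
      = (\<Sum>n\<in>R. \<Sum>p | p \<in> P \<and> h p = n. card {q \<in> P. h q = h p})"
    by (intro sum.cong) (auto simp: power2_eq_square)
  also have "\<dots> = (\<Sum>p\<in>P. card {q \<in> P. h q = h p})"
    by (rule sum.group[OF assms])
  also have "\<dots> = card (SIGMA p:P. {q \<in> P. h q = h p})"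
    using assms by simp
  also have "(SIGMA p:P. {q \<in> P. h q = h p}) = {(p, q). p \<in> P \<and> q \<in> P \<and> h q = h p}"
    by auto
  finally show ?thesis .
qed

text \<open>Representations are ordered here, while \<open>B2_set\<close> counts sorted ones; hence
  the factor \<open>2\<close> in the bound \<open>2 * g\<close>.\<close>

definition sum_count :: "int set \<Rightarrow> int \<Rightarrow> nat" where
  "sum_count A n = card {(a, a'). a \<in> A \<and> a' \<in> A \<and> a + a' = n}"

lemma diff_count_fibre: "diff_count A n = card {p \<in> A \<times> A. fst p - snd p = n}"
  unfolding diff_count_def by (rule arg_cong[where f = card]) auto

lemma sum_count_fibre: "sum_count A n = card {p \<in> A \<times> A. fst p + snd p = n}"
  unfolding sum_count_def by (rule arg_cong[where f = card]) auto

lemma diff_count_0: "diff_count A 0 = card A"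
proof -
  have "{(a, a'). a \<in> A \<and> a' \<in> A \<and> a - a' = 0} = (\<lambda>a. (a, a)) ` A" by auto
  then show ?thesis by (simp add: diff_count_def card_image inj_on_def)
qed

lemma diff_count_minus: "diff_count A (- n) = diff_count A n"
proof -
  have "bij_betw prod.swap {(a, a'). a \<in> A \<and> a' \<in> A \<and> a - a' = - n}
      {(a, a'). a \<in> A \<and> a' \<in> A \<and> a - a' = n}"
    by (rule bij_betw_byWitness[where f' = prod.swap]) auto
  then show ?thesis unfolding diff_count_def by (rule bij_betw_same_card)
qed

lemma sum_symmetric_interval:
  fixes f :: "int \<Rightarrow> 'b::comm_semiring_1"
  assumes "\<And>n. f (- n) = f n"
  shows "(\<Sum>n\<in>{- int N..int N}. f n) = f 0 + 2 * (\<Sum>n=1..N. f (int n))"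
proof -
  have "{- int N..int N} = insert 0 ({1..int N} \<union> uminus ` {1..int N})"
    by auto
  moreover have "0 \<notin> {1..int N} \<union> uminus ` {1..int N}" "{1..int N} \<inter> uminus ` {1..int N} = {}"
    by auto
  ultimately have "(\<Sum>n\<in>{- int N..int N}. f n) = f 0 + (sum f {1..int N} + sum f (uminus ` {1..int N}))"
    by (simp add: sum.union_disjoint del: image_uminus_atLeastAtMost)
  also have "sum f (uminus ` {1..int N}) = sum f {1..int N}"
    by (subst sum.reindex) (simp_all add: assms)
  also have "sum f {1..int N} = (\<Sum>n=1..N. f (int n))"
    using sum.reindex[of int "{1..N}" f] by (simp add: image_int_atLeastAtMost)
  finally show ?thesis by (simp add: mult_2)
qed

context
  fixes A :: "int set" and N :: nat
  assumes A: "A \<subseteq> {0..int N}"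
begin

lemma finite_A: "finite A"
  using A finite_subset by blast

lemma A_bounds:
  assumes "a \<in> A"
  shows "0 \<le> a" "a \<le> int N"
  using A assms by auto

lemma differences_subset: "(\<lambda>p. fst p - snd p) ` (A \<times> A) \<subseteq> {- int N..int N}"
proof (clarsimp)
  fix a a' assume "a \<in> A" "a' \<in> A"
  then show "- int N \<le> a - a' \<and> a - a' \<le> int N"
    using A_bounds[of a] A_bounds[of a'] by linarith
qed

lemma sums_subset: "(\<lambda>p. fst p + snd p) ` (A \<times> A) \<subseteq> {0..2 * int N}"
proof (clarsimp)
  fix a a' assume "a \<in> A" "a' \<in> A"
  then show "0 \<le> a + a' \<and> a + a' \<le> 2 * int N"
    using A_bounds[of a] A_bounds[of a'] by linarith
qed

lemma sum_diff_count: "(\<Sum>n\<in>{- int N..int N}. diff_count A n) = (card A)\<^sup>2"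
  unfolding diff_count_fibre
  by (subst sum_card_fibre[OF _ _ differences_subset])
    (simp_all add: finite_A card_cartesian_product power2_eq_square)

lemma sum_sum_count: "(\<Sum>n\<in>{0..2 * int N}. sum_count A n) = (card A)\<^sup>2"
  unfolding sum_count_fibre
  by (subst sum_card_fibre[OF _ _ sums_subset])
    (simp_all add: finite_A card_cartesian_product power2_eq_square)

text \<open>Both sides count the additive quadruples, as \<open>a - a' = c - c'\<close> iff \<open>a + c' = c + a'\<close>.\<close>

lemma additive_energy:
  "(\<Sum>n\<in>{- int N..int N}. (diff_count A n)\<^sup>2) = (\<Sum>n\<in>{0..2 * int N}. (sum_count A n)\<^sup>2)"
proof -
  let ?D = "{(p, q). p \<in> A \<times> A \<and> q \<in> A \<times> A \<and> fst q - snd q = fst p - snd p}"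
  let ?E = "{(p, q). p \<in> A \<times> A \<and> q \<in> A \<times> A \<and> fst q + snd q = fst p + snd p}"
  \<comment> \<open>Exchanging the second entries is an involution, so the map is its own
    inverse.\<close>
  let ?f = "\<lambda>((a, a'), (c, c')). ((a, c'), (c, a'))"
  have "bij_betw ?f ?D ?E"
    by (rule bij_betw_byWitness[where f' = ?f]) auto
  then have "card ?D = card ?E" by (rule bij_betw_same_card)
  moreover have "(\<Sum>n\<in>{- int N..int N}. (diff_count A n)\<^sup>2) = card ?D"
    unfolding diff_count_fibre
    by (subst sum_card_fibre_square[OF _ _ differences_subset]) (simp_all add: finite_A)
  moreover have "(\<Sum>n\<in>{0..2 * int N}. (sum_count A n)\<^sup>2) = card ?E"
    unfolding sum_count_fibre
    by (subst sum_card_fibre_square[OF _ _ sums_subset]) (simp_all add: finite_A)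
  ultimately show ?thesis by simp
qed

text \<open>Every representation is sorted or becomes sorted by a swap.\<close>

lemma sum_count_le:
  assumes "B2_set g A"
  shows "sum_count A n \<le> 2 * g"
proof -
  let ?P = "{(a, a'). a \<in> A \<and> a' \<in> A \<and> a \<le> a' \<and> a + a' = n}"
  have P: "finite ?P" "card ?P \<le> g" using assms by (auto simp: B2_set_def)
  have "{(a, a'). a \<in> A \<and> a' \<in> A \<and> a + a' = n} \<subseteq> ?P \<union> prod.swap ` ?P"
    by (auto simp: image_iff)
  then have "sum_count A n \<le> card (?P \<union> prod.swap ` ?P)"
    unfolding sum_count_def using P by (intro card_mono) auto
  also have "\<dots> \<le> card ?P + card (prod.swap ` ?P)" by (rule card_Un_le)
  also have "\<dots> \<le> card ?P + card ?P" using P by (intro add_left_mono card_image_le)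
  finally show ?thesis using P by simp
qed

text \<open>If \<open>diff_count A (int N) = 1\<close> then \<open>0\<close> and \<open>N\<close> lie in \<open>A\<close>, and each of the sums \<open>0\<close> and
  \<open>2 * N\<close> has a single representation, which is less than \<open>2 * g\<close>.\<close>

lemma energy_le:
  assumes "g > 0" "N > 0" and B: "B2_set g A"
  shows "(\<Sum>n\<in>{- int N..int N}. (diff_count A n)\<^sup>2) + 2 * (diff_count A (int N))\<^sup>2
    \<le> 2 * g * (card A)\<^sup>2"
proof -
  let ?d = "diff_count A (int N)"
  \<comment> \<open>The extra term \<open>2 * ?d\<^sup>2\<close> is shared equally by the extreme
    sums \<open>0\<close> and \<open>2 * int N\<close>.\<close>
  define e where "e n = (if n = 0 \<or> n = 2 * int N then ?d\<^sup>2 else 0)" for n :: int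
  have d: "?d = (if 0 \<in> A \<and> int N \<in> A then 1 else 0)"
  proof -
    have "a = int N \<and> a' = 0" if "a \<in> A" "a' \<in> A" "a - a' = int N" for a a'
      using A_bounds[of a] A_bounds[of a'] that by linarith
    then have "{(a, a'). a \<in> A \<and> a' \<in> A \<and> a - a' = int N}
        = (if 0 \<in> A \<and> int N \<in> A then {(int N, 0)} else {})"
      by auto
    then show ?thesis by (simp add: diff_count_def)
  qed
  have ends: "sum_count A 0 = 1" "sum_count A (2 * int N) = 1" if "0 \<in> A" "int N \<in> A"
  proof -
    have "a = 0 \<and> a' = 0" if "a \<in> A" "a' \<in> A" "a + a' = 0" for a a'
      using A_bounds[of a] A_bounds[of a'] that by linarith
    moreover have "a = int N \<and> a' = int N" if "a \<in> A" "a' \<in> A" "a + a' = 2 * int N" for a a'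
      using A_bounds[of a] A_bounds[of a'] that by linarith
    ultimately have "{(a, a'). a \<in> A \<and> a' \<in> A \<and> a + a' = 0} = {(0, 0)}"
      "{(a, a'). a \<in> A \<and> a' \<in> A \<and> a + a' = 2 * int N} = {(int N, int N)}"
      using that by auto
    then show "sum_count A 0 = 1" "sum_count A (2 * int N) = 1" by (simp_all add: sum_count_def)
  qed
  have "(sum_count A n)\<^sup>2 + e n \<le> 2 * g * sum_count A n" for n
  proof (cases "(n = 0 \<or> n = 2 * int N) \<and> 0 \<in> A \<and> int N \<in> A")
    case True
    \<comment> \<open>Here \<open>sum_count A n\<close> and \<open>?d\<close> are both
      \<open>1\<close>, and the claim is \<open>1 + 1 \<le> 2 * g\<close>.\<close>
    then show ?thesis using ends d \<open>g > 0\<close> by (auto simp: e_def)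
  next
    case False
    then show ?thesis using sum_count_le[OF B, of n] d by (auto simp: e_def power2_eq_square)
  qed
  then have "(\<Sum>n\<in>{0..2 * int N}. (sum_count A n)\<^sup>2 + e n) \<le> (\<Sum>n\<in>{0..2 * int N}. 2 * g * sum_count A n)"
    by (intro sum_mono)
  also have "\<dots> = 2 * g * (card A)\<^sup>2" by (simp add: sum_sum_count flip: sum_distrib_left)
  finally have "(\<Sum>n\<in>{0..2 * int N}. (sum_count A n)\<^sup>2) + sum e {0..2 * int N} \<le> 2 * g * (card A)\<^sup>2"
    by (simp add: sum.distrib)
  moreover have "sum e {0..2 * int N} = sum e {0, 2 * int N}"
    by (intro sum.mono_neutral_right) (auto simp: e_def)
  \<comment> \<open>As \<open>N > 0\<close>, the two extreme sums are distinct and both copies of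
    \<open>?d\<^sup>2\<close> are present.\<close>
  ultimately show ?thesis using \<open>N > 0\<close> by (simp add: additive_energy e_def)
qed

end

section \<open>Sampling the weight\<close>

text \<open>By compactness the supremum in \<open>A_const\<close> is a genuine upper bound.
  Differentiating \<open>w (- t) = w t\<close> at \<open>0\<close> shows that
  \<open>deriv w 0\<close> equals its own negative.\<close>

lemma C2_even_bounds:
  assumes C2: "C2_function w" and even: "\<And>t. w (- t) = w t"
  obtains W where "\<And>t. (w has_real_derivative deriv w t) (at t)"
    "\<And>t. (deriv w has_real_derivative deriv (deriv w) t) (at t)"
    "\<And>t. t \<in> {0..1} \<Longrightarrow> \<bar>deriv (deriv w) t\<bar> \<le> W"
    "deriv w 0 = 0" "W \<ge> 0" "A_const w = \<bar>deriv w 1\<bar> + W"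
proof
  let ?W = "SUP t\<in>{0..1}. \<bar>deriv (deriv w) t\<bar>"
  show w: "(w has_real_derivative deriv w t) (at t)"
    and w': "(deriv w has_real_derivative deriv (deriv w) t) (at t)" for t
    using C2 by (auto simp: C2_function_def DERIV_deriv_iff_real_differentiable)
  have "continuous_on {0..1} (\<lambda>t. \<bar>deriv (deriv w) t\<bar>)"
    using C2 by (auto simp: C2_function_def intro!: continuous_intros intro: continuous_on_subset)
  then have "bdd_above ((\<lambda>t. \<bar>deriv (deriv w) t\<bar>) ` {0..1})"
    by (intro bounded_imp_bdd_above compact_imp_bounded compact_continuous_image) auto
  then show W: "\<bar>deriv (deriv w) t\<bar> \<le> ?W" if "t \<in> {0..1}" for t
    using that by (intro cSUP_upper) auto
  show "?W \<ge> 0" using W[of 0] by simp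
  show "A_const w = \<bar>deriv w 1\<bar> + ?W" by (simp add: A_const_def)
  have "((\<lambda>t. w (- t)) has_real_derivative deriv w 0 * - 1) (at 0)"
    using w[of 0] by (intro DERIV_chain2[where g = uminus]) (auto intro!: derivative_eq_intros)
  then have "(w has_real_derivative deriv w 0 * - 1) (at 0)" by (simp add: even)
  from DERIV_unique[OF this w] show "deriv w 0 = 0" by simp
qed

lemma A_const_nonneg:
  assumes "C2_function w" "\<And>t. w (- t) = w t"
  shows "A_const w \<ge> 0"
  by (rule C2_even_bounds[OF assms]) auto

text \<open>The factor \<open>1 / N\<close> is left out, so for \<open>N > 0\<close> the total mass
  on \<open>{..N}\<close> is \<open>N\<close>. These weights also define the discrete measure for
  Cauchy--Schwarz.\<close>

definition trapezoid_weight :: "nat \<Rightarrow> nat \<Rightarrow> real" where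
  "trapezoid_weight N n = (if n = 0 \<or> n = N then 1 / 2 else 1)"

lemma sum_trapezoid_weight:
  assumes "N > 0"
  shows "(\<Sum>n\<le>N. trapezoid_weight N n * x n) = (\<Sum>n<N. (x n + x (Suc n)) / 2)"
proof -
  have "(\<Sum>n\<le>N. trapezoid_weight N n * x n)
      = (\<Sum>n\<le>N. x n - (if n = 0 then x n / 2 else 0) - (if n = N then x n / 2 else 0))"
    using assms by (intro sum.cong) (auto simp: trapezoid_weight_def)
  also have "\<dots> = (\<Sum>n\<le>N. x n) - x 0 / 2 - x N / 2"
    by (simp add: sum_subtractf sum.delta)
  \<comment> \<open>The full sum is the average of two copies of itself, one with the last term
    split off and one with the first.\<close>
  also have "(\<Sum>n\<le>N. x n) = ((\<Sum>n<N. x n) + x N + (x 0 + (\<Sum>n<N. x (Suc n)))) / 2"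
    using sum.lessThan_Suc[of x N] sum.lessThan_Suc_shift[of x N] by (simp add: lessThan_Suc_atMost)
  also have "\<dots> - x 0 / 2 - x N / 2 = (\<Sum>n<N. (x n + x (Suc n)) / 2)"
    by (simp add: sum.distrib field_simps flip: sum_divide_distrib)
  finally show ?thesis .
qed

text \<open>The constant majorant \<open>W\<close> gives the error
  \<open>W / (8 * N\<^sup>2)\<close>. An upper bound suffices, since the mean will be multiplied by
  a nonnegative number.\<close>

lemma trapezoid_mean_le:
  assumes C2: "C2_function w" and even: "\<And>t. w (- t) = w t" and "N > 0"
  shows "(\<Sum>n\<le>N. trapezoid_weight N n * w (n / N)) / N \<le> I1 w + A_const w / (4 * real N ^ 2)"
proof -
  obtain W where w: "\<And>t. (w has_real_derivative deriv w t) (at t)"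
      "\<And>t. (deriv w has_real_derivative deriv (deriv w) t) (at t)"
    and W: "\<And>t. t \<in> {0..1} \<Longrightarrow> \<bar>deriv (deriv w) t\<bar> \<le> W"
    and "deriv w 0 = 0" and W0: "W \<ge> 0" and A: "A_const w = \<bar>deriv w 1\<bar> + W"
    using C2_even_bounds[OF C2 even] by blast
  have "(\<Sum>n\<le>N. trapezoid_weight N n * w (n / N)) / N
      \<le> integral {0..1} w + integral {0..1} (\<lambda>_::real. W) / (8 * real N ^ 2)"
    unfolding sum_trapezoid_weight[OF \<open>N > 0\<close>]
  proof (rule trapezoid_rule[OF \<open>N > 0\<close> w])
    show "deriv (deriv w) t \<le> W" if "t \<in> {0..1}" for t using W[OF that] by simp
  qed (use W0 in auto)
  moreover have "W / (8 * real N ^ 2) \<le> A_const w / (4 * real N ^ 2)"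
    using W0 A \<open>N > 0\<close> by (intro frac_le) auto
  ultimately show ?thesis by (simp add: I1_def)
qed

text \<open>The interval has length \<open>1\<close>, so \<open>I1 w\<close> is the mean of
  \<open>w\<close> and \<open>I2 w - (I1 w)\<^sup>2\<close> its variance.\<close>

lemma variance_identity:
  assumes contw: "continuous_on {0..1} w"
  shows "integral {0..1} (\<lambda>t. w t - I1 w) = 0"
    and "integral {0..1} (\<lambda>t. (w t - I1 w)\<^sup>2) = I2 w - (I1 w)\<^sup>2"
proof -
  have w_int: "(w has_integral I1 w) {0..1}" "((\<lambda>t. (w t)\<^sup>2) has_integral I2 w) {0..1}"
    unfolding I1_def I2_def
    by (intro integrable_integral integrable_continuous_real continuous_intros contw)+
  have c_int: "((\<lambda>_. c) has_integral c) {0..1::real}" for c :: real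
    using has_integral_const_real[of c 0 1] by simp
  show "integral {0..1} (\<lambda>t. w t - I1 w) = 0"
    using has_integral_diff[OF w_int(1) c_int[of "I1 w"]] by (simp add: integral_unique)
  have "((\<lambda>t. (w t)\<^sup>2 - 2 * I1 w * w t + (I1 w)\<^sup>2) has_integral
      (I2 w - 2 * I1 w * I1 w + (I1 w)\<^sup>2)) {0..1}"
    by (intro has_integral_add has_integral_diff has_integral_mult_right w_int c_int)
  moreover have "(\<lambda>t. (w t)\<^sup>2 - 2 * I1 w * w t + (I1 w)\<^sup>2) = (\<lambda>t. (w t - I1 w)\<^sup>2)"
    by (simp add: power2_diff algebra_simps)
  ultimately show "integral {0..1} (\<lambda>t. (w t - I1 w)\<^sup>2) = I2 w - (I1 w)\<^sup>2"
    by (simp add: integral_unique power2_eq_square)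
qed

lemma I1_square_le_I2:
  assumes "continuous_on {0..1} w"
  shows "(I1 w)\<^sup>2 \<le> I2 w"
proof -
  have "integral {0..1} (\<lambda>t. (w t - I1 w)\<^sup>2) \<ge> 0"
    by (intro integral_nonneg integrable_continuous_real continuous_intros assms) auto
  then show ?thesis by (simp add: variance_identity[OF assms])
qed

lemma C2_function_continuous_on:
  assumes "C2_function w"
  shows "continuous_on X w"
  using assms unfolding C2_function_def
  by (intro continuous_at_imp_continuous_on ballI differentiable_imp_continuous_within) auto

lemma trapezoid_variance_le:
  assumes C2: "C2_function w" and even: "\<And>t. w (- t) = w t" and "N > 0"
  shows "(\<Sum>n\<le>N. trapezoid_weight N n * (w (n / N) - I1 w)\<^sup>2) / N
    \<le> (sqrt (I2 w - (I1 w)\<^sup>2) + A_const w / (2 * sqrt 2 * real N powr (3 / 2)))\<^sup>2"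
proof -
  obtain W where w: "\<And>t. (w has_real_derivative deriv w t) (at t)"
      "\<And>t. (deriv w has_real_derivative deriv (deriv w) t) (at t)"
    and W: "\<And>t. t \<in> {0..1} \<Longrightarrow> \<bar>deriv (deriv w) t\<bar> \<le> W"
    and w0: "deriv w 0 = 0" and W0: "W \<ge> 0" and A: "A_const w = \<bar>deriv w 1\<bar> + W"
    using C2_even_bounds[OF C2 even] by blast
  define f where "f t = w t - I1 w" for t
  have contw: "continuous_on Y w" and contw': "continuous_on Y (deriv w)" for Y
    using w by (meson DERIV_continuous_on has_field_derivative_at_within)+
  have contw'': "continuous_on {0..1} (deriv (deriv w))"
    using C2 by (auto simp: C2_function_def intro: continuous_on_subset)
  have contf: "continuous_on Y f" for Y
    unfolding f_def by (intro continuous_intros contw)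
  have f: "(f has_real_derivative deriv w t) (at t)" for t
    unfolding f_def using w(1)[of t] by (auto intro!: derivative_eq_intros)
  note mean = variance_identity(1)[OF contw, folded f_def] and f2 = variance_identity(2)[OF contw, folded f_def]
  define s where "s = sqrt (I2 w - (I1 w)\<^sup>2)"
  define X where "X = sqrt (integral {0..1} (\<lambda>t. (deriv w t)\<^sup>2))"
  have s: "s \<ge> 0" "s\<^sup>2 = integral {0..1} (\<lambda>t. (f t)\<^sup>2)" using I1_square_le_I2[OF contw] by (auto simp: s_def f2)
  have "integral {0..1} (\<lambda>t. (deriv w t)\<^sup>2) \<ge> 0"
    by (intro integral_nonneg integrable_continuous_real continuous_intros contw') auto
  then have X: "X \<ge> 0" "X\<^sup>2 = integral {0..1} (\<lambda>t. (deriv w t)\<^sup>2)" by (auto simp: X_def)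
  note bounds = integral_derivative_square_le[OF f w(2) contw'' W w0 mean,
      folded X_def, unfolded f2, folded s_def]
  \<comment> \<open>This majorises the second derivative \<open>2 * f'\<^sup>2 + 2 * f * f''\<close>
    of the square of \<open>f\<close>.\<close>
  let ?E = "\<lambda>t. 2 * (deriv w t)\<^sup>2 + 2 * W * \<bar>f t\<bar>"
  have contE: "continuous_on {0..1} ?E"
    by (intro continuous_intros contw' contf)
  have "integral {0..1} ?E = 2 * X\<^sup>2 + 2 * W * integral {0..1} (\<lambda>t. \<bar>f t\<bar>)"
    unfolding X
    by (intro integral_unique has_integral_add has_integral_mult_right integrable_integral
        integrable_continuous_real continuous_intros contw' contf)
  also have "\<dots> \<le> 2 * X\<^sup>2 + 2 * W * s"
    using bounds(1) W0 by (intro add_left_mono mult_left_mono) auto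
  finally have intE: "integral {0..1} ?E \<le> 2 * (X\<^sup>2 + s * W)" by (simp add: mult_ac)
  have "(\<Sum>n\<le>N. trapezoid_weight N n * (f (n / N))\<^sup>2) / N
      \<le> integral {0..1} (\<lambda>t. (f t)\<^sup>2) + integral {0..1} ?E / (8 * real N ^ 2)"
    unfolding sum_trapezoid_weight[OF \<open>N > 0\<close>]
  proof (rule trapezoid_rule[OF \<open>N > 0\<close>, where G' = "\<lambda>t. 2 * f t * deriv w t"
        and G'' = "\<lambda>t. 2 * (deriv w t)\<^sup>2 + 2 * (f t * deriv (deriv w) t)", OF _ _ contE])
    show "((\<lambda>t. (f t)\<^sup>2) has_real_derivative 2 * f t * deriv w t) (at t)" for t
      by (rule derivative_eq_intros f refl | simp)+
    show "((\<lambda>t. 2 * f t * deriv w t) has_real_derivative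
        2 * (deriv w t)\<^sup>2 + 2 * (f t * deriv (deriv w) t)) (at t)" for t
      by (rule derivative_eq_intros f w refl | simp add: power2_eq_square)+
    fix t :: real assume t: "t \<in> {0..1}"
    show "0 \<le> ?E t" using W0 by simp
    have "f t * deriv (deriv w) t \<le> \<bar>deriv (deriv w) t\<bar> * \<bar>f t\<bar>"
      by (metis abs_ge_self abs_mult mult.commute)
    also have "\<dots> \<le> W * \<bar>f t\<bar>" using W[OF t] by (intro mult_right_mono) auto
    finally show "2 * (deriv w t)\<^sup>2 + 2 * (f t * deriv (deriv w) t) \<le> ?E t" by simp
  qed
  also have "\<dots> \<le> s\<^sup>2 + 2 * (X\<^sup>2 + s * W) / (8 * real N ^ 2)"
    unfolding s by (intro add_left_mono divide_right_mono intE) auto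
  also have "\<dots> = s\<^sup>2 + (X\<^sup>2 + s * W) / (4 * real N ^ 2)"
    using \<open>N > 0\<close> by (simp add: field_simps)
  also have "\<dots> \<le> (s + A_const w / (2 * sqrt 2 * real N powr (3 / 2)))\<^sup>2"
    unfolding A using \<open>N > 0\<close> W0 s(1) X(1) bounds(2) by (intro sampling_interpolation) auto
  finally show ?thesis by (simp add: f_def s_def)
qed

text \<open>The function \<open>f\<close> is centred at its weighted mean, which makes its weighted
  sum vanish, so \<open>h\<close> may be centred at any \<open>c\<close>. This permits
  \<open>c = I1 w\<close> in place of the sampled mean. The first claim says that the radicand is
  nonnegative.\<close>

lemma Cauchy_Schwarz_centred:
  fixes v f h :: "'a \<Rightarrow> real"
  assumes "\<And>i. i \<in> I \<Longrightarrow> v i \<ge> 0" and L: "(\<Sum>i\<in>I. v i) = L" "L > 0"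
  shows "(\<Sum>i\<in>I. v i * f i)\<^sup>2 / L \<le> (\<Sum>i\<in>I. v i * (f i)\<^sup>2)"
    and "(\<Sum>i\<in>I. v i * (f i * h i)) \<le> (\<Sum>i\<in>I. v i * f i) * ((\<Sum>i\<in>I. v i * h i) / L)
    + sqrt ((\<Sum>i\<in>I. v i * (f i)\<^sup>2) - (\<Sum>i\<in>I. v i * f i)\<^sup>2 / L) * sqrt (\<Sum>i\<in>I. v i * (h i - c)\<^sup>2)"
proof -
  define F where "F = (\<Sum>i\<in>I. v i * f i)"
  define m where "m = F / L"
  have F: "F = m * L" using L by (simp add: m_def)
  have "(\<Sum>i\<in>I. v i * (f i - m)\<^sup>2) = (\<Sum>i\<in>I. v i * (f i)\<^sup>2) - 2 * m * F + m\<^sup>2 * (\<Sum>i\<in>I. v i)"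
    unfolding F_def sum_distrib_left sum_subtractf[symmetric] sum.distrib[symmetric]
    by (intro sum.cong) (auto simp: power2_eq_square algebra_simps)
  also have "\<dots> = (\<Sum>i\<in>I. v i * (f i)\<^sup>2) - F\<^sup>2 / L"
    using L by (simp add: F power2_eq_square)
  finally have var: "(\<Sum>i\<in>I. v i * (f i - m)\<^sup>2) = (\<Sum>i\<in>I. v i * (f i)\<^sup>2) - F\<^sup>2 / L" .
  have "(\<Sum>i\<in>I. v i * (f i - m)\<^sup>2) \<ge> 0" using assms by (intro sum_nonneg) auto
  then show "(\<Sum>i\<in>I. v i * f i)\<^sup>2 / L \<le> (\<Sum>i\<in>I. v i * (f i)\<^sup>2)" by (simp add: var F_def[symmetric])
  \<comment> \<open>The two added terms cancel because \<open>F = m * L\<close>.\<close>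
  have "(\<Sum>i\<in>I. v i * (f i * h i)) - m * (\<Sum>i\<in>I. v i * h i)
      = (\<Sum>i\<in>I. v i * (f i * h i)) - m * (\<Sum>i\<in>I. v i * h i) - c * F + m * c * (\<Sum>i\<in>I. v i)"
    by (simp add: L F)
  also have "\<dots> = (\<Sum>i\<in>I. v i * ((f i - m) * (h i - c)))"
    unfolding F_def sum_distrib_left sum_subtractf[symmetric] sum.distrib[symmetric]
    by (intro sum.cong) (auto simp: algebra_simps)
  also have "\<dots> = (\<Sum>i\<in>I. (sqrt (v i) * (f i - m)) * (sqrt (v i) * (h i - c)))"
    using assms by (intro sum.cong) (auto simp: algebra_simps)
  also have "\<dots> \<le> sqrt ((\<Sum>i\<in>I. (sqrt (v i) * (f i - m))\<^sup>2) * (\<Sum>i\<in>I. (sqrt (v i) * (h i - c))\<^sup>2))"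
    by (intro real_le_rsqrt Cauchy_Schwarz_ineq_sum)
  also have "(\<Sum>i\<in>I. (sqrt (v i) * (h i - c))\<^sup>2) = (\<Sum>i\<in>I. v i * (h i - c)\<^sup>2)"
    using assms by (intro sum.cong) (auto simp: power_mult_distrib)
  also have "(\<Sum>i\<in>I. (sqrt (v i) * (f i - m))\<^sup>2) = (\<Sum>i\<in>I. v i * (f i - m)\<^sup>2)"
    using assms by (intro sum.cong) (auto simp: power_mult_distrib)
  also note var
  finally show "(\<Sum>i\<in>I. v i * (f i * h i)) \<le> (\<Sum>i\<in>I. v i * f i) * ((\<Sum>i\<in>I. v i * h i) / L)
    + sqrt ((\<Sum>i\<in>I. v i * (f i)\<^sup>2) - (\<Sum>i\<in>I. v i * f i)\<^sup>2 / L) * sqrt (\<Sum>i\<in>I. v i * (h i - c)\<^sup>2)"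
    by (simp add: real_sqrt_mult m_def F_def)
qed

section \<open>Combining the additive energy with the sampled mean and variance\<close>

theorem theorem4:
  fixes g N :: nat and A :: "int set" and S :: "real set" and b :: "real \<Rightarrow> real"
  assumes "g > 0" and "N > 0"
    and "A \<subseteq> {0..int N}" and "B2_set g A"
    and "admissible S b" and "C2_function (weight S b)"
  shows "D_sum N A S b \<le>
      (I1 (weight S b) + A_const (weight S b) / (4 * real N ^ 2)) * real (card A) ^ 2
    + (weight S b 0 - I1 (weight S b)) * real (card A)
    + (sqrt (2 * (I2 (weight S b) - (I1 (weight S b)) ^ 2))
        + A_const (weight S b) / (2 * real N powr (3 / 2)))
      * sqrt ((2 * real g - 1) * real N * real (card A) ^ 2
              - real (card A) ^ 4 / 2 + real (card A) ^ 3)"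
proof -
  define w where "w = weight S b"
  have even: "w (- t) = w t" for t by (simp add: w_def weight_def)
  have C2: "C2_function w" using assms by (simp add: w_def)
  define M where "M = real (card A)"
  define d where "d n = real (diff_count A (int n))" for n
  define v where "v = trapezoid_weight N"
  \<comment> \<open>The doubling at \<open>N\<close> compensates for the weight \<open>1 / 2\<close>.\<close>
  define f where "f n = (if n = 0 then 0 else if n = N then 2 * d N else d n)" for n
  define V where "V = (\<Sum>n\<le>N. v n * (w (n / N) - I1 w)\<^sup>2)"
  define T where "T = (2 * real g - 1) * real N * M ^ 2 - M ^ 4 / 2 + M ^ 3"
  have fold: "(\<Sum>n\<in>{- int N..int N}. real (diff_count A n) * h n)
      = M * h 0 + 2 * (\<Sum>n=1..N. d n * h (int n))" if "\<And>n. h (- n) = h n" for h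
    using sum_symmetric_interval[of "\<lambda>n. real (diff_count A n) * h n" N] that
    by (simp add: diff_count_minus diff_count_0 M_def d_def)
  have split: "(\<Sum>n\<le>N. x n) = x 0 + (\<Sum>n=1..N. x n)" for x :: "nat \<Rightarrow> real"
    by (simp add: sum.atLeast_Suc_atMost flip: atLeast0AtMost)
  \<comment> \<open>The value \<open>f 0 = 0\<close> removes the diagonal, which enters
    \<open>D_sum\<close> separately as \<open>M * w 0\<close>; at \<open>N\<close> the product
    \<open>v N * f N\<close> is \<open>d N\<close>.\<close>
  have vf: "(\<Sum>n\<le>N. v n * (f n * h n)) = (\<Sum>n=1..N. d n * h n)" for h
    unfolding split by (auto simp: f_def v_def trapezoid_weight_def intro!: sum.cong)
  have D: "D_sum N A S b = M * w 0 + 2 * (\<Sum>n\<le>N. v n * (f n * w (n / N)))"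
    unfolding D_sum_def vf w_def[symmetric]
    using fold[of "\<lambda>n. w (real_of_int n / real N)"] even by simp
  have F: "(\<Sum>n\<le>N. v n * f n) = (M\<^sup>2 - M) / 2"
  proof -
    have "M\<^sup>2 = real (\<Sum>n\<in>{- int N..int N}. diff_count A n)"
      using sum_diff_count[OF assms(3)] by (simp add: M_def)
    also have "\<dots> = M + 2 * (\<Sum>n=1..N. d n)" using fold[of "\<lambda>_. 1"] by simp
    finally show ?thesis using vf[of "\<lambda>_. 1"] by simp
  qed
  \<comment> \<open>The node \<open>N\<close> contributes \<open>1 / 2 * (2 * d N)\<^sup>2\<close>,
    one \<open>(d N)\<^sup>2\<close> more than its share of the energy. \<open>energy_le\<close> has
    room for exactly this surplus.\<close>
  have Q: "(\<Sum>n\<le>N. v n * (f n)\<^sup>2) \<le> (2 * real g - 1) * M\<^sup>2 / 2"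
  proof -
    have "(\<Sum>n\<le>N. v n * (f n)\<^sup>2) = (\<Sum>n=1..N. d n * f n)"
      using vf[of f] by (simp add: power2_eq_square)
    also have "\<dots> = (\<Sum>n=1..N. (d n)\<^sup>2 + (if n = N then (d n)\<^sup>2 else 0))"
      by (intro sum.cong) (auto simp: f_def power2_eq_square)
    also have "\<dots> = (\<Sum>n=1..N. (d n)\<^sup>2) + (d N)\<^sup>2"
      using \<open>N > 0\<close> by (simp add: sum.distrib sum.delta)
    finally have "(\<Sum>n\<le>N. v n * (f n)\<^sup>2) = (\<Sum>n=1..N. (d n)\<^sup>2) + (d N)\<^sup>2" .
    moreover have "real (\<Sum>n\<in>{- int N..int N}. (diff_count A n)\<^sup>2) = M\<^sup>2 + 2 * (\<Sum>n=1..N. (d n)\<^sup>2)"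
      using fold[of "\<lambda>n. real (diff_count A n)"]
      by (simp add: diff_count_minus diff_count_0 power2_eq_square M_def d_def)
    moreover have "real (\<Sum>n\<in>{- int N..int N}. (diff_count A n)\<^sup>2) + 2 * (d N)\<^sup>2 \<le> 2 * real g * M\<^sup>2"
      using energy_le[OF assms(3,1,2,4)] unfolding M_def d_def
      by (metis (mono_tags) of_nat_add of_nat_le_iff of_nat_mult of_nat_numeral of_nat_power)
    ultimately show ?thesis by (simp add: algebra_simps)
  qed
  have v: "(\<Sum>n\<le>N. v n) = real N" "\<And>n. v n \<ge> 0"
    using sum_trapezoid_weight[OF \<open>N > 0\<close>, of "\<lambda>_. 1"]
    by (auto simp: v_def trapezoid_weight_def)
  have CS: "((M\<^sup>2 - M) / 2)\<^sup>2 / N \<le> (\<Sum>n\<le>N. v n * (f n)\<^sup>2)"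
    "(\<Sum>n\<le>N. v n * (f n * w (n / N)))
      \<le> (M\<^sup>2 - M) / 2 * ((\<Sum>n\<le>N. v n * w (n / N)) / N)
        + sqrt ((\<Sum>n\<le>N. v n * (f n)\<^sup>2) - ((M\<^sup>2 - M) / 2)\<^sup>2 / N) * sqrt V"
    unfolding F[symmetric] V_def using \<open>N > 0\<close>
    by (intro Cauchy_Schwarz_centred v; simp)+
  have M: "(M\<^sup>2 - M) / 2 \<ge> 0"
  proof -
    have "card A \<le> (card A)\<^sup>2" by (simp add: power2_eq_square)
    then show ?thesis by (simp add: M_def flip: of_nat_power)
  qed
  have VT: "(\<Sum>n\<le>N. v n * (f n)\<^sup>2) - ((M\<^sup>2 - M) / 2)\<^sup>2 / N \<le> T / (2 * N)"
  proof -
    have "(\<Sum>n\<le>N. v n * (f n)\<^sup>2) - ((M\<^sup>2 - M) / 2)\<^sup>2 / N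
        \<le> (2 * real g - 1) * M\<^sup>2 / 2 - ((M\<^sup>2 - M) / 2)\<^sup>2 / N"
      using Q by simp
    \<comment> \<open>Removing the diagonal replaces \<open>M\<^sup>2\<close> by
      \<open>M\<^sup>2 - M\<close>; expanding its square yields the cubic term of \<open>T\<close>
      and a negative term that is dropped.\<close>
    also have "\<dots> = T / (2 * N) - M\<^sup>2 / (4 * N)"
      using \<open>N > 0\<close> by (simp add: T_def field_simps power2_eq_square power3_eq_cube power4_eq_xxxx)
    also have "\<dots> \<le> T / (2 * N)" by simp
    finally show ?thesis .
  qed
  define B where "B = sqrt (I2 w - (I1 w)\<^sup>2) + A_const w / (2 * sqrt 2 * real N powr (3 / 2))"
  have "V / N \<le> B\<^sup>2"
    unfolding v_def V_def B_def using C2 even \<open>N > 0\<close> by (rule trapezoid_variance_le)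
  then have "V \<le> real N * B\<^sup>2" using \<open>N > 0\<close> by (simp add: field_simps)
  moreover have "B \<ge> 0"
    using A_const_nonneg[OF C2 even] I1_square_le_I2[OF C2_function_continuous_on[OF C2]] by (simp add: B_def)
  ultimately have V: "sqrt V \<le> sqrt N * B"
    using real_sqrt_le_mono[of V "real N * B\<^sup>2"] by (simp add: real_sqrt_mult)
  note CS(2)
  also have "(M\<^sup>2 - M) / 2 * ((\<Sum>n\<le>N. v n * w (n / N)) / N)
        + sqrt ((\<Sum>n\<le>N. v n * (f n)\<^sup>2) - ((M\<^sup>2 - M) / 2)\<^sup>2 / N) * sqrt V
      \<le> (M\<^sup>2 - M) / 2 * (I1 w + A_const w / (4 * real N ^ 2)) + sqrt (T / (2 * N)) * (sqrt N * B)"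
  proof (intro add_mono mult_mono[OF _ V] mult_left_mono M)
    show "(\<Sum>n\<le>N. v n * w (n / N)) / N \<le> I1 w + A_const w / (4 * real N ^ 2)"
      unfolding v_def using C2 even \<open>N > 0\<close> by (rule trapezoid_mean_le)
    \<comment> \<open>\<open>CS(1)\<close> and \<open>VT\<close> together force \<open>T\<close> to
      be nonnegative.\<close>
    show "0 \<le> sqrt (T / (2 * N))" using CS(1) VT by simp
    show "0 \<le> sqrt V" by (auto simp: V_def v intro!: sum_nonneg)
  qed (use VT in simp)
  also have "sqrt (T / (2 * N)) * (sqrt N * B) = sqrt 2 * B * sqrt T / 2"
    using \<open>N > 0\<close> by (simp add: real_sqrt_divide real_sqrt_mult field_simps)
  finally have "D_sum N A S b \<le> M * w 0 + (M\<^sup>2 - M) * (I1 w + A_const w / (4 * real N ^ 2)) + sqrt 2 * B * sqrt T"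
    unfolding D using mult_left_mono[of _ _ "2 :: real"] by (fastforce simp: distrib_left)
  \<comment> \<open>Only the nonnegative error term is enlarged; \<open>I1 w\<close> has no known
    sign and keeps its exact factor, which produces \<open>(w 0 - I1 w) * M\<close>.\<close>
  also have "(M\<^sup>2 - M) * (I1 w + A_const w / (4 * real N ^ 2))
      \<le> (M\<^sup>2 - M) * I1 w + M\<^sup>2 * (A_const w / (4 * real N ^ 2))"
    using mult_right_mono[of "M\<^sup>2 - M" "M\<^sup>2" "A_const w / (4 * real N ^ 2)"] A_const_nonneg[OF C2 even]
    by (simp add: M_def distrib_left)
  also have "M * w 0 + ((M\<^sup>2 - M) * I1 w + M\<^sup>2 * (A_const w / (4 * real N ^ 2)))
      = (I1 w + A_const w / (4 * real N ^ 2)) * M ^ 2 + (w 0 - I1 w) * M"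
    by (simp add: algebra_simps)
  also have "sqrt 2 * B = sqrt (2 * (I2 w - (I1 w)\<^sup>2)) + A_const w / (2 * real N powr (3 / 2))"
    unfolding B_def real_sqrt_mult by (simp add: distrib_left)
  finally show ?thesis by (simp add: w_def M_def T_def)
qed

end
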